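(* Let $\alpha_0,\alpha_1,\alpha_2,\alpha_3\in\mathbb{R}$ and let $\mathcal{F}$ be the set of all continuously differentiable functions $f:[0,1]\to\mathbb{R}$ with $\int_0^1 x^kf(x)\,dx=\alpha_k$ for $k=0,1,2,3$. Put $$\Delta_0:=6\alpha_2-6\alpha_1+\alpha_0,\qquad \Delta_1:=10\alpha_3-12\alpha_2+3\alpha_1,\qquad D:=60(3\alpha_2-2\alpha_3-\alpha_1).$$ (i) If $\Delta_0\ge 0$ and $\Delta_1\le 0$, then $D$ is the right endpoint of the optimal range interval of $\mathcal{F}$; that is, $D\in\mathrm{Range}(f')$ for every $f\in\mathcal{F}$, and for every $\varepsilon>0$ there exists $f\in\mathcal{F}$ with $\mathrm{Range}(f')\subseteq(-\infty,D+\varepsilon)$. (ii) If $0\le\Delta_0\le\Delta_1$, then $D$ is the left endpoint of the optimal range interval of $\mathcal{F}$; that is, $D\in\mathrm{Range}(f')$ for every $f\in\mathcal{F}$, and for every $\varepsilon>0$ there exists $f\in\mathcal{F}$ with $\mathrm{Range}(f')\subseteq(D-\varepsilon,\infty)$. (iii) If $\Delta_0=\Delta_1=0$, then the optimal range interval of $\mathcal{F}$ is $[A,B]$ with $A=B=20(4\alpha_3-3\alpha_2)$, and the optimal length of $\mathcal{F}$ is $L=0$.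
   Context: For a set $\mathcal{F}$ of continuously differentiable functions on $[0,1]$: (1) The optimal range interval of $\mathcal{F}$ is the largest interval $[A,B]$ (with $A\le B$ real, $A=B$ allowed) such that $[A,B]\subseteq \mathrm{Range}(f')$ for every $f\in\mathcal{F}$; that is, $[A,B]$ has this property and contains every other such interval with this property. (2) The optimal length of $\mathcal{F}$ is the largest number $L\ge 0$ such that for every $f\in\mathcal{F}$ there is an interval $[a,b]$ (possibly depending on $f$) with $b-a=L$ and $[a,b]\subseteq \mathrm{Range}(f')$. Here $\mathrm{Range}(f')=f'([0,1])$. *)

theory Defs
  imports "HOL-Analysis.Analysis"
begin

text \<open>
  A function on the unit interval is represented by a total function on the reals; only its
  values on \<open>{0..1}\<close> matter, since all derivatives are taken within \<open>{0..1}\<close> and hence are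
  one-sided at the two endpoints.
\<close>

definition unit_deriv :: "(real \<Rightarrow> real) \<Rightarrow> real \<Rightarrow> real" where
  "unit_deriv f x = vector_derivative f (at x within {0..1})"

definition C1_unit :: "(real \<Rightarrow> real) \<Rightarrow> bool" where
  "C1_unit f \<longleftrightarrow> f differentiable_on {0..1} \<and> continuous_on {0..1} (unit_deriv f)"

definition deriv_range :: "(real \<Rightarrow> real) \<Rightarrow> real set" where
  "deriv_range f = unit_deriv f ` {0..1}"

definition moment_class :: "nat \<Rightarrow> (nat \<Rightarrow> real) \<Rightarrow> (real \<Rightarrow> real) set" where
  "moment_class n \<alpha> = {f. C1_unit f \<and> (\<forall>k\<le>n. integral {0..1} (\<lambda>x. x ^ k * f x) = \<alpha> k)}"

definition common_range_interval :: "(real \<Rightarrow> real) set \<Rightarrow> real \<Rightarrow> real \<Rightarrow> bool" where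
  "common_range_interval F A B \<longleftrightarrow> A \<le> B \<and> (\<forall>f\<in>F. {A..B} \<subseteq> deriv_range f)"

definition optimal_range_interval :: "(real \<Rightarrow> real) set \<Rightarrow> real \<Rightarrow> real \<Rightarrow> bool" where
  "optimal_range_interval F A B \<longleftrightarrow>
     common_range_interval F A B \<and>
     (\<forall>A' B'. common_range_interval F A' B' \<longrightarrow> {A'..B'} \<subseteq> {A..B})"

definition admissible_length :: "(real \<Rightarrow> real) set \<Rightarrow> real \<Rightarrow> bool" where
  "admissible_length F L \<longleftrightarrow>
     L \<ge> 0 \<and> (\<forall>f\<in>F. \<exists>a b. b - a = L \<and> {a..b} \<subseteq> deriv_range f)"

definition optimal_length :: "(real \<Rightarrow> real) set \<Rightarrow> real \<Rightarrow> bool" where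
  "optimal_length F L \<longleftrightarrow>
     admissible_length F L \<and> (\<forall>L'. admissible_length F L' \<longrightarrow> L' \<le> L)"

end

theory Submission
  imports Defs
begin

text \<open>
  Integrating by parts against polynomials that vanish at \<open>0\<close> and \<open>1\<close>, the moments
  \<open>\<alpha>\<^sub>0, \<dots>, \<alpha>\<^sub>3\<close> prescribe exactly the integrals of \<open>x (1 - x) r(x) f'(x)\<close> for quadratic \<open>r\<close>,
  the constant of integration in \<open>f\<close> being free. The choice \<open>r = x (1 - x)\<close> shows that \<open>D\<close> is a
  mean of \<open>f'\<close> with a nonnegative weight, so \<open>D\<close> is a value of \<open>f'\<close>. The choices \<open>r = 2 x - 1\<close>
  and \<open>r = x (5 x - 3)\<close> annihilate constants and give \<open>\<Delta>\<^sub>0\<close> and \<open>2 \<Delta>\<^sub>1\<close>; the three functionals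
  applied to \<open>d - p (1 - x)^n - q x^n\<close> form a linear system for \<open>d\<close>, \<open>p\<close>, \<open>q\<close>. In its solution
  \<open>d\<close> tends to \<open>D\<close> as \<open>n\<close> grows, and the sign conditions on \<open>\<Delta>\<^sub>0\<close> and \<open>\<Delta>\<^sub>1\<close> give \<open>p\<close> and \<open>q\<close> the
  same sign, so that \<open>f'\<close> stays on one side of \<open>d\<close>.
\<close>

section \<open>Derivatives on the unit interval and integration by parts\<close>

lemma has_vector_derivative_unit_deriv:
  assumes "f differentiable_on {0..1}" "x \<in> {0..1}"
  shows "(f has_vector_derivative unit_deriv f x) (at x within {0..1})"
  using assms unfolding unit_deriv_def differentiable_on_def
  by (simp add: vector_derivative_works)

lemma unit_deriv_eqI:
  assumes "(f has_field_derivative d) (at x)" "x \<in> {0..1}"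
  shows "unit_deriv f x = d"
  using assms unfolding unit_deriv_def
  by (intro vector_derivative_at_within_ivl)
     (auto simp: has_real_derivative_iff_has_vector_derivative)

lemma deriv_range_interval:
  assumes "C1_unit f"
  shows "\<exists>l u. deriv_range f = {l..u}"
proof -
  have c: "continuous_on {0..1} (unit_deriv f)"
    using assms by (simp add: C1_unit_def)
  have "connected (deriv_range f)" "compact (deriv_range f)"
    unfolding deriv_range_def
    using c by (auto intro: connected_continuous_image compact_continuous_image)
  then show ?thesis
    by (metis connected_compact_interval_1)
qed

text \<open>Integrate the derivative of \<open>\<phi> * f\<close>: the boundary terms vanish with
  \<open>\<phi>\<close> at \<open>0\<close> and \<open>1\<close>. The product rule is applied within
  \<open>{0..1}\<close>, since \<open>f\<close> has only one-sided derivatives at the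
  endpoints.\<close>

lemma has_integral_mult_unit_deriv:
  fixes \<phi> \<phi>' :: "real \<Rightarrow> real"
  assumes f: "C1_unit f"
    and \<phi>: "\<And>x. (\<phi> has_field_derivative \<phi>' x) (at x)" "\<phi> 0 = 0" "\<phi> 1 = 0"
    and I: "((\<lambda>x. \<phi>' x * f x) has_integral I) {0..1}"
  shows "((\<lambda>x. \<phi> x * unit_deriv f x) has_integral - I) {0..1}"
proof -
  have "((\<lambda>x. \<phi> x * f x) has_vector_derivative (\<phi>' x * f x + \<phi> x * unit_deriv f x))
          (at x within {0..1})" if "x \<in> {0..1}" for x
  proof -
    have "(\<phi> has_field_derivative \<phi>' x) (at x within {0..1})"
      using \<phi>(1) has_field_derivative_at_within by blast
    moreover have "(f has_field_derivative unit_deriv f x) (at x within {0..1})"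
      using has_vector_derivative_unit_deriv f that
      by (auto simp: C1_unit_def has_real_derivative_iff_has_vector_derivative)
    ultimately have "((\<lambda>x. \<phi> x * f x) has_field_derivative
        (\<phi>' x * f x + unit_deriv f x * \<phi> x)) (at x within {0..1})"
      by (rule DERIV_mult)
    then show ?thesis
      by (simp add: has_real_derivative_iff_has_vector_derivative mult.commute)
  qed
  then have "((\<lambda>x. \<phi>' x * f x + \<phi> x * unit_deriv f x) has_integral (\<phi> 1 * f 1 - \<phi> 0 * f 0)) {0..1}"
    by (intro fundamental_theorem_of_calculus) auto
  from has_integral_diff[OF this I] \<phi>(2,3) show ?thesis by simp
qed

lemma moment_class_has_integral:
  assumes "f \<in> moment_class n \<alpha>" "k \<le> n"
  shows "((\<lambda>x. x ^ k * f x) has_integral \<alpha> k) {0..1}"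
proof -
  have "continuous_on {0..1} f"
    using assms by (auto simp: moment_class_def C1_unit_def intro: differentiable_imp_continuous_on)
  \<comment> \<open>\<open>integral\<close> takes a default value on non-integrable functions, so
    integrability has to be secured before the moment equation becomes a \<open>has_integral\<close>
    fact.\<close>
  then have "(\<lambda>x. x ^ k * f x) integrable_on {0..1}"
    by (intro integrable_continuous_real continuous_intros)
  then show ?thesis
    using assms by (auto simp: moment_class_def has_integral_iff)
qed

section \<open>\<open>D\<close> as a weighted mean of the derivative\<close>

lemma quartic_weight_integral_unit_deriv:
  assumes "f \<in> moment_class 3 \<alpha>"
  shows "((\<lambda>x. (x * (1 - x))\<^sup>2 * unit_deriv f x) has_integral
           2 * (3 * \<alpha> 2 - 2 * \<alpha> 3 - \<alpha> 1)) {0..1}"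
proof -
  note m = moment_class_has_integral[OF assms]
  \<comment> \<open>The coefficients are those of the derivative of
    \<open>(x * (1 - x))\<^sup>2\<close>, a cubic, so four moments suffice.\<close>
  have "((\<lambda>x. 2 * (x ^ 1 * f x) + (- 6) * (x ^ 2 * f x) + 4 * (x ^ 3 * f x)) has_integral
      2 * \<alpha> 1 + (- 6) * \<alpha> 2 + 4 * \<alpha> 3) {0..1}"
    by (intro has_integral_add has_integral_mult_right m) auto
  then have "((\<lambda>x. (2 * x - 6 * x ^ 2 + 4 * x ^ 3) * f x) has_integral
      2 * \<alpha> 1 + (- 6) * \<alpha> 2 + 4 * \<alpha> 3) {0..1}"
    by (rule has_integral_eq[rotated]) (auto simp: algebra_simps)
  then have "((\<lambda>x. (x * (1 - x))\<^sup>2 * unit_deriv f x) has_integral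
      - (2 * \<alpha> 1 + (- 6) * \<alpha> 2 + 4 * \<alpha> 3)) {0..1}"
  proof (rule has_integral_mult_unit_deriv[rotated 4])
    show "C1_unit f" using assms by (simp add: moment_class_def)
    show "((\<lambda>x::real. (x * (1 - x))\<^sup>2) has_field_derivative 2 * x - 6 * x ^ 2 + 4 * x ^ 3) (at x)" for x
      by (auto intro!: derivative_eq_intros simp: power2_eq_square power3_eq_cube algebra_simps)
  qed auto
  then show ?thesis by (simp add: algebra_simps)
qed

text \<open>The image is a compact interval with ends \<open>l\<close> and \<open>u\<close>.
  Integrating \<open>w * l \<le> w * g \<le> w * u\<close> and dividing by the mass \<open>W\<close>
  puts \<open>d\<close> between them.\<close>

lemma weighted_mean_in_image:
  fixes w g :: "real \<Rightarrow> real"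
  assumes w: "\<And>x. x \<in> {a..b} \<Longrightarrow> 0 \<le> w x"
    and g: "continuous_on {a..b} g"
    and W: "(w has_integral W) {a..b}" "W > 0"
    and I: "((\<lambda>x. w x * g x) has_integral W * d) {a..b}"
  shows "d \<in> g ` {a..b}"
proof -
  obtain l u where lu: "g ` {a..b} = {l..u}"
    using connected_compact_interval_1[of "g ` {a..b}"] g
    by (auto intro: connected_continuous_image compact_continuous_image)
  have "l \<le> g x" "g x \<le> u" if "x \<in> {a..b}" for x
    using lu that by (metis atLeastAtMost_iff image_eqI)+
  then have "W * l \<le> W * d" "W * d \<le> W * u"
    using w by (auto intro!: has_integral_le[OF has_integral_mult_left[OF W(1)] I] 
      has_integral_le[OF I has_integral_mult_left[OF W(1)]] mult_left_mono)
  then show ?thesis using W(2) lu by simp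
qed

lemma moment_class_mean_in_deriv_range:
  assumes "f \<in> moment_class 3 \<alpha>"
  shows "60 * (3 * \<alpha> 2 - 2 * \<alpha> 3 - \<alpha> 1) \<in> deriv_range f"
  unfolding deriv_range_def
\<comment> \<open>The weight has mass \<open>1 / 30\<close>, which turns the factor \<open>2\<close>
  of the quartic integral into the \<open>60\<close> of \<open>D\<close>.\<close>
proof (rule weighted_mean_in_image[where w = "\<lambda>x. (x * (1 - x))\<^sup>2" and W = "1 / 30"])
  show "continuous_on {0..1} (unit_deriv f)"
    using assms by (simp add: moment_class_def C1_unit_def)
  show "((\<lambda>x::real. (x * (1 - x))\<^sup>2) has_integral 1 / 30) {0..1}"
  proof -
    have "((\<lambda>x::real. x ^ 3 / 3 - x ^ 4 / 2 + x ^ 5 / 5) has_vector_derivative (x * (1 - x))\<^sup>2)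
        (at x within {0..1})" for x
      unfolding has_real_derivative_iff_has_vector_derivative[symmetric]
      by (auto intro!: derivative_eq_intros simp: power2_eq_square eval_nat_numeral algebra_simps)
    from fundamental_theorem_of_calculus[OF zero_le_one this] show ?thesis by simp
  qed
  show "((\<lambda>x. (x * (1 - x))\<^sup>2 * unit_deriv f x) has_integral
      1 / 30 * (60 * (3 * \<alpha> 2 - 2 * \<alpha> 3 - \<alpha> 1))) {0..1}"
    using quartic_weight_integral_unit_deriv[OF assms] by (rule has_integral_eq_rhs) simp
qed auto

section \<open>Existence of the optimal range interval\<close>

lemma ex_optimal_range_interval:
  assumes F: "F \<subseteq> Collect C1_unit" "f\<^sub>0 \<in> F" and d: "\<And>f. f \<in> F \<Longrightarrow> d \<in> deriv_range f"
  shows "\<exists>A B. optimal_range_interval F A B"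
proof -
  \<comment> \<open>This intersection of compact intervals is the optimal interval itself. The
    member \<open>f\<^sub>0\<close> bounds it, and the common value \<open>d\<close> makes it
    nonempty, so that \<open>A \<le> B\<close>.\<close>
  let ?S = "\<Inter>f\<in>F. deriv_range f"
  have "closed ?S" "connected ?S" "bounded ?S"
  proof -
    have *: "\<exists>l u. deriv_range f = {l..u}" if "f \<in> F" for f
      using F that deriv_range_interval by blast
    show "closed ?S" using * by (metis closed_INT closed_atLeastAtMost)
    show "bounded ?S" using *[OF F(2)] F(2)
      by (metis INF_lower bounded_closed_interval bounded_subset)
    have "is_interval ?S" unfolding is_interval_1
    proof (intro ballI allI impI INT_I)
      fix a b x f assume "a \<in> ?S" "b \<in> ?S" "a \<le> x \<and> x \<le> b" "f \<in> F"
      moreover from this have "a \<in> deriv_range f" "b \<in> deriv_range f" by blast+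
      moreover obtain l u where "deriv_range f = {l..u}" using *[OF \<open>f \<in> F\<close>] by blast
      ultimately show "x \<in> deriv_range f" by auto
    qed
    then show "connected ?S" by (simp add: is_interval_connected_1)
  qed
  then obtain A B where AB: "?S = {A..B}"
    by (metis connected_compact_interval_1 compact_eq_bounded_closed)
  have "A \<le> B" using d AB by (metis INT_I atLeastAtMost_iff order_trans)
  then have "optimal_range_interval F A B"
    unfolding optimal_range_interval_def common_range_interval_def AB[symmetric] by auto
  then show ?thesis by blast
qed

text \<open>The degenerate interval \<open>{d..d}\<close> competes in the maximality
  condition.\<close>

lemma optimal_range_interval_contains:
  assumes "optimal_range_interval F A B" "\<And>f. f \<in> F \<Longrightarrow> d \<in> deriv_range f"
  shows "d \<in> {A..B}"
proof -
  have "common_range_interval F d d"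
    using assms by (auto simp: common_range_interval_def)
  then show ?thesis using assms(1) by (fastforce simp: optimal_range_interval_def)
qed

lemma optimal_range_interval_endpoints_in_deriv_range:
  assumes "optimal_range_interval F A B" "f \<in> F"
  shows "A \<in> deriv_range f" "B \<in> deriv_range f"
  using assms by (auto simp: optimal_range_interval_def common_range_interval_def subset_iff)

section \<open>Beta integrals and a family of functions with the prescribed moments\<close>

lemma beta_has_integral:
  "((\<lambda>x::real. x ^ k * (1 - x) ^ m) has_integral fact k * fact m / fact (k + m + 1)) {0..1}"
proof (induction k arbitrary: m)
  case 0
  have "((\<lambda>x::real. - ((1 - x) ^ Suc m / real (Suc m))) has_vector_derivative (1 - x) ^ m) (at x within {0..1})" for x
    unfolding has_real_derivative_iff_has_vector_derivative[symmetric]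
    by (auto intro!: derivative_eq_intros simp del: power_Suc)
  from fundamental_theorem_of_calculus[OF zero_le_one this] show ?case by simp
next
  case (Suc k)
  \<comment> \<open>This function vanishes at both ends, so its derivative has integral
    \<open>0\<close>. That trades a factor \<open>x\<close> for a factor \<open>1 - x\<close>, which
    is why the induction keeps \<open>m\<close> arbitrary.\<close>
  have "((\<lambda>x::real. x ^ Suc k * (1 - x) ^ Suc m) has_vector_derivative
      real (Suc k) * (x ^ k * (1 - x) ^ Suc m) - real (Suc m) * (x ^ Suc k * (1 - x) ^ m))
      (at x within {0..1})" for x
    unfolding has_real_derivative_iff_has_vector_derivative[symmetric]
    by (auto intro!: derivative_eq_intros simp del: power_Suc)
  from fundamental_theorem_of_calculus[OF zero_le_one this]
  have 1: "((\<lambda>x::real. real (Suc k) * (x ^ k * (1 - x) ^ Suc m) - real (Suc m) * (x ^ Suc k * (1 - x) ^ m))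
     has_integral 0) {0..1}" by simp
  have "((\<lambda>x::real. x ^ Suc k * (1 - x) ^ m) has_integral
     (real (Suc k) * (fact k * fact (Suc m) / fact (k + Suc m + 1)) - 0) / real (Suc m)) {0..1}"
    using has_integral_divide[OF has_integral_diff[OF
        has_integral_mult_right[OF Suc.IH[of "Suc m"], of "real (Suc k)"] 1], of "real (Suc m)"]
    by (rule has_integral_eq[rotated]) (simp add: field_simps)
  then show ?case
    by (rule has_integral_eq_rhs) (simp add: fact_Suc[of k] fact_Suc[of m] del: fact_Suc)
qed

lemma power_moment_has_integral:
  "((\<lambda>x::real. x ^ k * x ^ m) has_integral 1 / real (k + m + 1)) {0..1}"
  using beta_has_integral[of "k + m" 0] by (simp add: power_add)

text \<open>The right-hand side is the explicit solution of the linear system for \<open>d\<close>,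
  \<open>p\<close>, \<open>q\<close>; its denominator \<open>n * (n - 1)\<close> forces
  \<open>n \<ge> 2\<close>. The witness is a primitive of it, and its moments are checked
  directly.\<close>

lemma ex_moment_class_unit_deriv:
  fixes \<alpha> :: "nat \<Rightarrow> real" and n :: nat
  defines "a \<equiv> 6 * \<alpha> 2 - 6 * \<alpha> 1 + \<alpha> 0"
    and "b \<equiv> 10 * \<alpha> 3 - 12 * \<alpha> 2 + 3 * \<alpha> 1"
  defines "N \<equiv> real (n + 2) * real (n + 3) * real (n + 4) / (real n * (real n - 1))"
  assumes n: "n \<ge> 2"
  shows "\<exists>f\<in>moment_class 3 \<alpha>. \<forall>x\<in>{0..1}. unit_deriv f x =
    60 * (3 * \<alpha> 2 - 2 * \<alpha> 3 - \<alpha> 1) + 60 * real (n + 2) * (a - 2 * b) / (real n * (real n - 1))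
      - N * (real (n + 2) * a - real (n + 5) * b) * (1 - x) ^ n
      - N * (3 * a - real (n + 5) * b) * x ^ n"
proof -
  define d where "d = 60 * (3 * \<alpha> 2 - 2 * \<alpha> 3 - \<alpha> 1)
    + 60 * real (n + 2) * (a - 2 * b) / (real n * (real n - 1))"
  define p where "p = N * (real (n + 2) * a - real (n + 5) * b)"
  define q where "q = N * (3 * a - real (n + 5) * b)"
  \<comment> \<open>The constant of integration, chosen so that the moment of order \<open>0\<close>
    is right.\<close>
  define c where "c = \<alpha> 0 - d / 2 - (p - q) / (real (n + 1) * real (n + 2))"
  define f where "f x = c + d * x + p / real (n + 1) * (1 - x) ^ (n + 1) - q / real (n + 1) * x ^ (n + 1)" for x
  define g where "g x = d - p * (1 - x) ^ n - q * x ^ n" for x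
  have deriv: "(f has_field_derivative g x) (at x)" for x
    unfolding f_def g_def
    by (auto intro!: derivative_eq_intros simp del: power_Suc)
  then have ud: "unit_deriv f x = g x" if "x \<in> {0..1}" for x
    using that by (rule unit_deriv_eqI)
  have "f differentiable_on {0..1}"
    using deriv by (meson differentiable_on_def differentiable_at_withinI real_differentiable_def)
  moreover have "continuous_on {0..1} (unit_deriv f)"
    by (subst continuous_on_cong[OF refl ud]) (auto simp: g_def intro!: continuous_intros)
  ultimately have C1: "C1_unit f" by (simp add: C1_unit_def)
  have I: "((\<lambda>x. x ^ k * f x) has_integral
      c / real (k + 1) + d / real (k + 2) + p / real (n + 1) * (fact k * fact (n + 1) / fact (k + n + 2))
        - q / real (n + 1) / real (k + n + 2)) {0..1}" for k
  proof -
    \<comment> \<open>\<open>1\<close> and \<open>x\<close> are written as powers so that the power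
      moment rule fits each monomial term.\<close>
    have "((\<lambda>x. c * (x ^ k * x ^ 0) + d * (x ^ k * x ^ 1) + p / real (n + 1) * (x ^ k * (1 - x) ^ (n + 1))
        - q / real (n + 1) * (x ^ k * x ^ (n + 1))) has_integral
      c * (1 / real (k + 0 + 1)) + d * (1 / real (k + 1 + 1))
        + p / real (n + 1) * (fact k * fact (n + 1) / fact (k + (n + 1) + 1))
        - q / real (n + 1) * (1 / real (k + (n + 1) + 1))) {0..1}"
      by (intro has_integral_add has_integral_diff has_integral_mult_right
          power_moment_has_integral beta_has_integral)
    then show ?thesis
      unfolding f_def
      by (rule has_integral_eq_rhs[OF has_integral_eq[rotated]]) (simp_all add: algebra_simps)
  qed
  \<comment> \<open>In terms of \<open>r > 0\<close> every denominator is a product of factors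
    \<open>r + i\<close> with \<open>i \<ge> 0\<close>, all nonzero.\<close>
  define r where "r = real n - 1"
  have r: "r > 0" "real n = r + 1" using n by (auto simp: r_def)
  then have nz: "r \<noteq> 0" "r + 1 \<noteq> 0" "r + 2 \<noteq> 0" "r + 3 \<noteq> 0" "r + 4 \<noteq> 0"
    "r + 5 \<noteq> 0" "r + 6 \<noteq> 0"
    by auto
  have B: "fact 0 * fact (n + 1) / fact (0 + n + 2) = 1 / (r + 3)"
    "fact 1 * fact (n + 1) / fact (1 + n + 2) = 1 / ((r + 4) * (r + 3))"
    "fact 2 * fact (n + 1) / fact (2 + n + 2) = 2 / ((r + 5) * (r + 4) * (r + 3))"
    "fact 3 * fact (n + 1) / fact (3 + n + 2) = 6 / ((r + 6) * (r + 5) * (r + 4) * (r + 3))"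
    by (simp_all add: r_def eval_nat_numeral divide_simps)
  define e where "e = 60 * (3 * \<alpha> 2 - 2 * \<alpha> 3 - \<alpha> 1)"
  have d: "d = e + 60 * (r + 3) * (a - 2 * b) / (r * (r + 1))"
    by (simp add: d_def e_def r add_ac mult_ac)
  have N: "N = (r + 3) * (r + 4) * (r + 5) / (r * (r + 1))"
    by (simp add: N_def r add_ac mult_ac)
  have p: "p = N * ((r + 3) * a - (r + 6) * b)" and q: "q = N * (3 * a - (r + 6) * b)"
    by (simp_all add: p_def q_def r add_ac)
  \<comment> \<open>The terms in \<open>b\<close> cancel in the difference, and so does the factor
    \<open>r\<close> in the denominator of \<open>N\<close>.\<close>
  have "p - q = N * (r * a)"
    unfolding p q by algebra
  then have c: "c = \<alpha> 0 - d / 2 - (r + 4) * (r + 5) * a / ((r + 1) * (r + 2))"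
    using nz by (simp add: c_def N r add_ac)
  have m0: "integral {0..1} (\<lambda>x. x ^ 0 * f x) = \<alpha> 0"
    using integral_unique[OF I[of 0]] unfolding B by (simp add: c_def r add_ac diff_divide_distrib)
  have m1: "integral {0..1} (\<lambda>x. x ^ 1 * f x) = \<alpha> 1"
  proof -
    \<comment> \<open>Cancelling the factors of \<open>N\<close> first keeps the rational identity
      below small. In that identity all dependence on \<open>r\<close> disappears, leaving a linear
      combination of the moments. Orders \<open>2\<close> and \<open>3\<close> go the same
      way.\<close>
    have "p / (r + 2) * (1 / ((r + 4) * (r + 3))) =
        (r + 5) * ((r + 3) * a - (r + 6) * b) / (r * (r + 1) * (r + 2))"
      and "q / (r + 2) / (r + 4) =
        (r + 3) * (r + 5) * (3 * a - (r + 6) * b) / (r * (r + 1) * (r + 2))"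
      using nz unfolding p q N by (simp_all add: mult_ac)
    then have "c / 2 + d / 3 + p / (r + 2) * (1 / ((r + 4) * (r + 3))) - q / (r + 2) / (r + 4) =
        \<alpha> 0 / 2 + e / 12 - a / 2 + b"
      using nz unfolding c d by (simp add: divide_simps) algebra
    also have "\<dots> = \<alpha> 1"
      by (simp add: a_def b_def e_def field_simps)
    finally show ?thesis
      using integral_unique[OF I[of 1]] unfolding B by (simp add: r_def)
  qed
  have m2: "integral {0..1} (\<lambda>x. x ^ 2 * f x) = \<alpha> 2"
  proof -
    have "p / (r + 2) * (2 / ((r + 5) * (r + 4) * (r + 3))) =
        2 * ((r + 3) * a - (r + 6) * b) / (r * (r + 1) * (r + 2))"
      and "q / (r + 2) / (r + 5) =
        (r + 3) * (r + 4) * (3 * a - (r + 6) * b) / (r * (r + 1) * (r + 2))"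
      using nz unfolding p q N by (simp_all add: mult_ac)
    then have "c / 3 + d / 4 + p / (r + 2) * (2 / ((r + 5) * (r + 4) * (r + 3))) - q / (r + 2) / (r + 5) =
        \<alpha> 0 / 3 + e / 12 - a / 3 + b"
      using nz unfolding c d by (simp add: divide_simps) algebra
    also have "\<dots> = \<alpha> 2"
      by (simp add: a_def b_def e_def field_simps)
    finally show ?thesis
      using integral_unique[OF I[of 2]] unfolding B by (simp add: r_def)
  qed
  have m3: "integral {0..1} (\<lambda>x. x ^ 3 * f x) = \<alpha> 3"
  proof -
    have "p / (r + 2) * (6 / ((r + 6) * (r + 5) * (r + 4) * (r + 3))) =
        6 * ((r + 3) * a - (r + 6) * b) / (r * (r + 1) * (r + 2) * (r + 6))"
      and "q / (r + 2) / (r + 6) =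
        (r + 3) * (r + 4) * (r + 5) * (3 * a - (r + 6) * b) / (r * (r + 1) * (r + 2) * (r + 6))"
      using nz unfolding p q N by (simp_all add: mult_ac)
    then have "c / 4 + d / 5 + p / (r + 2) * (6 / ((r + 6) * (r + 5) * (r + 4) * (r + 3))) - q / (r + 2) / (r + 6) =
        \<alpha> 0 / 4 + 3 * e / 40 - a / 4 + b"
      using nz unfolding c d by (simp add: divide_simps) algebra
    also have "\<dots> = \<alpha> 3"
      by (simp add: a_def b_def e_def field_simps)
    finally show ?thesis
      using integral_unique[OF I[of 3]] unfolding B by (simp add: r_def)
  qed
  have "integral {0..1} (\<lambda>x. x ^ k * f x) = \<alpha> k" if "k \<le> 3" for k
  proof -
    have "k = 0 \<or> k = 1 \<or> k = 2 \<or> k = 3" using that by linarith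
    then show ?thesis
      using m0 m1 m2 m3 by blast
  qed
  with C1 have "f \<in> moment_class 3 \<alpha>" by (simp add: moment_class_def)
  then show ?thesis
    using ud unfolding g_def d_def p_def q_def by blast
qed

lemma ex_small_offset:
  fixes K \<epsilon> :: real
  assumes "\<epsilon> > 0"
  shows "\<exists>n\<ge>2. \<bar>60 * real (n + 2) * K / (real n * (real n - 1))\<bar> < \<epsilon>"
proof -
  obtain m :: nat where "240 * \<bar>K\<bar> / \<epsilon> < real m" using reals_Archimedean2 by blast
  then obtain n :: nat where n: "240 * \<bar>K\<bar> / \<epsilon> < real n" "n \<ge> 2"
    using that[of "max m 2"] by simp
  have "\<bar>60 * real (n + 2) * K / (real n * (real n - 1))\<bar> = 60 * real (n + 2) * \<bar>K\<bar> / (real n * (real n - 1))"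
    using n(2) by (simp add: abs_mult)
  \<comment> \<open>For \<open>n \<ge> 2\<close>, \<open>n + 2 \<le> 4 * (n - 1)\<close>; the factor
    \<open>n - 1\<close> then cancels and a bound of order \<open>1 / n\<close> remains.\<close>
  also have "\<dots> \<le> 60 * (4 * (real n - 1)) * \<bar>K\<bar> / (real n * (real n - 1))"
    using n(2) by (intro divide_right_mono mult_right_mono mult_left_mono) auto
  also have "\<dots> = 240 * \<bar>K\<bar> / real n"
    using n(2) by (simp add: divide_simps)
  also have "\<dots> < \<epsilon>"
    using n assms by (simp add: field_simps)
  finally show ?thesis using n(2) by blast
qed

section \<open>Derivatives on one side of \<open>D\<close>, up to a small error\<close>

context
  fixes \<alpha> :: "nat \<Rightarrow> real" and a b D :: real
  assumes a_def: "a = 6 * \<alpha> 2 - 6 * \<alpha> 1 + \<alpha> 0"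
    and b_def: "b = 10 * \<alpha> 3 - 12 * \<alpha> 2 + 3 * \<alpha> 1"
    and D_def: "D = 60 * (3 * \<alpha> 2 - 2 * \<alpha> 3 - \<alpha> 1)"
begin

lemma ex_unit_deriv_near_mean:
  assumes "\<epsilon> > 0"
  obtains f n d p q where "f \<in> moment_class 3 \<alpha>"
    "\<And>x. x \<in> {0..1} \<Longrightarrow> unit_deriv f x = d - p * (1 - x) ^ n - q * x ^ n"
    "\<bar>d - D\<bar> < \<epsilon>"
    "b \<le> 0 \<Longrightarrow> b \<le> a \<Longrightarrow> p \<ge> 0 \<and> q \<ge> 0"
    "b \<ge> 0 \<Longrightarrow> a \<le> b \<Longrightarrow> p \<le> 0 \<and> q \<le> 0"
proof -
  obtain n where n: "n \<ge> 2"
    and small: "\<bar>60 * real (n + 2) * (a - 2 * b) / (real n * (real n - 1))\<bar> < \<epsilon>"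
    using ex_small_offset[OF assms] by blast
  define N where "N = real (n + 2) * real (n + 3) * real (n + 4) / (real n * (real n - 1))"
  define p where "p = N * (real (n + 2) * a - real (n + 5) * b)"
  define q where "q = N * (3 * a - real (n + 5) * b)"
  obtain f where f: "f \<in> moment_class 3 \<alpha>"
    and deriv: "\<And>x. x \<in> {0..1} \<Longrightarrow> unit_deriv f x =
      D + 60 * real (n + 2) * (a - 2 * b) / (real n * (real n - 1)) - p * (1 - x) ^ n - q * x ^ n"
    using ex_moment_class_unit_deriv[OF n, of \<alpha>] unfolding a_def b_def D_def p_def q_def N_def by blast
  have "N \<ge> 0" using n by (auto simp: N_def)
  \<comment> \<open>Regrouped in \<open>a - b\<close> and \<open>b\<close>, both coefficients have a
    visible sign once \<open>b\<close> and \<open>a - b\<close> have opposite signs.\<close>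
  have p: "p = N * (real (n + 2) * (a - b) - 3 * b)" and q: "q = N * (3 * (a - b) - real (n + 2) * b)"
    unfolding p_def q_def by (simp_all add: algebra_simps)
  show thesis
  proof (rule that[OF f deriv])
    assume "b \<le> 0" "b \<le> a"
    then have "3 * b \<le> 0" "0 \<le> real (n + 2) * (a - b)" "real (n + 2) * b \<le> 0" "0 \<le> 3 * (a - b)"
      by (auto intro!: mult_nonneg_nonpos mult_nonneg_nonneg simp del: of_nat_add)
    with \<open>N \<ge> 0\<close> show "p \<ge> 0 \<and> q \<ge> 0"
      unfolding p q by (intro conjI mult_nonneg_nonneg) linarith+
  next
    assume "b \<ge> 0" "a \<le> b"
    then have "0 \<le> 3 * b" "real (n + 2) * (a - b) \<le> 0" "0 \<le> real (n + 2) * b" "3 * (a - b) \<le> 0"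
      by (auto intro!: mult_nonneg_nonpos mult_nonneg_nonneg simp del: of_nat_add)
    with \<open>N \<ge> 0\<close> show "p \<le> 0 \<and> q \<le> 0"
      unfolding p q by (intro conjI mult_nonneg_nonpos) linarith+
  qed (use small in auto)
qed

lemma ex_deriv_range_below:
  assumes "b \<le> 0" "b \<le> a" "\<epsilon> > 0"
  shows "\<exists>f\<in>moment_class 3 \<alpha>. deriv_range f \<subseteq> {..<D + \<epsilon>}"
proof -
  obtain f n d p q where f: "f \<in> moment_class 3 \<alpha>"
    "\<And>x. x \<in> {0..1} \<Longrightarrow> unit_deriv f x = d - p * (1 - x) ^ n - q * x ^ n"
    "\<bar>d - D\<bar> < \<epsilon>" and pq: "p \<ge> 0" "q \<ge> 0"
    using ex_unit_deriv_near_mean[OF \<open>\<epsilon> > 0\<close>] assms by metis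
  have "unit_deriv f x < D + \<epsilon>" if x: "x \<in> {0..1}" for x
  proof -
    have "p * (1 - x) ^ n \<ge> 0" "q * x ^ n \<ge> 0"
      using x pq by auto
    then show ?thesis using f(2)[OF x] f(3) by linarith
  qed
  then show ?thesis by (intro bexI[OF _ f(1)]) (auto simp: deriv_range_def)
qed

lemma ex_deriv_range_above:
  assumes "b \<ge> 0" "a \<le> b" "\<epsilon> > 0"
  shows "\<exists>f\<in>moment_class 3 \<alpha>. deriv_range f \<subseteq> {D - \<epsilon><..}"
proof -
  obtain f n d p q where f: "f \<in> moment_class 3 \<alpha>"
    "\<And>x. x \<in> {0..1} \<Longrightarrow> unit_deriv f x = d - p * (1 - x) ^ n - q * x ^ n"
    "\<bar>d - D\<bar> < \<epsilon>" and pq: "p \<le> 0" "q \<le> 0"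
    using ex_unit_deriv_near_mean[OF \<open>\<epsilon> > 0\<close>] assms by metis
  have "unit_deriv f x > D - \<epsilon>" if x: "x \<in> {0..1}" for x
  proof -
    have "p * (1 - x) ^ n \<le> 0" "q * x ^ n \<le> 0"
      using x pq by (auto intro!: mult_nonpos_nonneg)
    then show ?thesis using f(2)[OF x] f(3) by linarith
  qed
  then show ?thesis by (intro bexI[OF _ f(1)]) (auto simp: deriv_range_def)
qed

text \<open>With \<open>a = b = 0\<close> the offset and both power terms vanish, so the derivative
  is exactly \<open>D\<close> already for \<open>n = 2\<close>.\<close>

lemma ex_deriv_range_singleton:
  assumes "a = 0" "b = 0"
  shows "\<exists>f\<in>moment_class 3 \<alpha>. deriv_range f = {D}"
proof -
  obtain f where f: "f \<in> moment_class 3 \<alpha>" "\<And>x. x \<in> {0..1} \<Longrightarrow> unit_deriv f x = D"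
    using ex_moment_class_unit_deriv[of 2 \<alpha>] assms
    unfolding a_def[symmetric] b_def[symmetric] D_def[symmetric] by auto
  then have "deriv_range f = {D}" by (force simp: deriv_range_def)
  then show ?thesis using f(1) by blast
qed

lemma ex_optimal_range_interval_moment_class:
  assumes "f\<^sub>0 \<in> moment_class 3 \<alpha>"
  obtains A B where "optimal_range_interval (moment_class 3 \<alpha>) A B" "A \<le> D" "D \<le> B"
proof -
  have D: "D \<in> deriv_range f" if "f \<in> moment_class 3 \<alpha>" for f
    using moment_class_mean_in_deriv_range[OF that] by (simp add: D_def)
  have "moment_class 3 \<alpha> \<subseteq> Collect C1_unit"
    by (auto simp: moment_class_def)
  then obtain A B where AB: "optimal_range_interval (moment_class 3 \<alpha>) A B"
    using ex_optimal_range_interval[OF _ assms D] by blast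
  then have "D \<in> {A..B}" by (rule optimal_range_interval_contains) (rule D)
  with AB that show ?thesis by simp
qed

end

section \<open>The three cases\<close>

theorem theorem3:
  fixes \<alpha> :: "nat \<Rightarrow> real" and F :: "(real \<Rightarrow> real) set" and \<Delta>0 \<Delta>1 D :: real
  assumes F: "F = moment_class 3 \<alpha>"
    and \<Delta>0: "\<Delta>0 = 6 * \<alpha> 2 - 6 * \<alpha> 1 + \<alpha> 0"
    and \<Delta>1: "\<Delta>1 = 10 * \<alpha> 3 - 12 * \<alpha> 2 + 3 * \<alpha> 1"
    and D: "D = 60 * (3 * \<alpha> 2 - 2 * \<alpha> 3 - \<alpha> 1)"
  shows "(\<Delta>0 \<ge> 0 \<and> \<Delta>1 \<le> 0 \<longrightarrow>
            (\<exists>A. optimal_range_interval F A D) \<and>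
            (\<forall>f\<in>F. D \<in> deriv_range f) \<and>
            (\<forall>\<epsilon>>0. \<exists>f\<in>F. deriv_range f \<subseteq> {..<D + \<epsilon>})) \<and>
         (0 \<le> \<Delta>0 \<and> \<Delta>0 \<le> \<Delta>1 \<longrightarrow>
            (\<exists>B. optimal_range_interval F D B) \<and>
            (\<forall>f\<in>F. D \<in> deriv_range f) \<and>
            (\<forall>\<epsilon>>0. \<exists>f\<in>F. deriv_range f \<subseteq> {D - \<epsilon><..})) \<and>
         (\<Delta>0 = 0 \<and> \<Delta>1 = 0 \<longrightarrow>
            optimal_range_interval F (20 * (4 * \<alpha> 3 - 3 * \<alpha> 2)) (20 * (4 * \<alpha> 3 - 3 * \<alpha> 2)) \<and>
            optimal_length F 0)"
proof (intro conjI impI)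
  note defs = \<Delta>0 \<Delta>1 D
  have mean: "D \<in> deriv_range f" if "f \<in> F" for f
    using moment_class_mean_in_deriv_range that by (simp add: F D)
  then show "\<forall>f\<in>F. D \<in> deriv_range f" "\<forall>f\<in>F. D \<in> deriv_range f" by blast+
  {
    assume "\<Delta>0 \<ge> 0 \<and> \<Delta>1 \<le> 0"
    then have below: "\<exists>f\<in>F. deriv_range f \<subseteq> {..<D + \<epsilon>}" if "\<epsilon> > 0" for \<epsilon>
      using ex_deriv_range_below[OF defs _ _ that] by (auto simp: F)
    then show "\<forall>\<epsilon>>0. \<exists>f\<in>F. deriv_range f \<subseteq> {..<D + \<epsilon>}" by blast
    \<comment> \<open>The value \<open>1\<close> is arbitrary: only a member of \<open>F\<close> is
      wanted, to have an optimal interval at all.\<close>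
    obtain f\<^sub>0 where "f\<^sub>0 \<in> F" using below[of 1] by auto
    then obtain A B where AB: "optimal_range_interval F A B" "D \<le> B"
      using ex_optimal_range_interval_moment_class[OF defs] unfolding F by metis
    \<comment> \<open>The endpoint \<open>B\<close> is a value of every derivative, in particular of
      one that stays below \<open>D + \<epsilon>\<close>.\<close>
    have "B \<le> D + \<epsilon>" if "\<epsilon> > 0" for \<epsilon>
      using below[OF that] optimal_range_interval_endpoints_in_deriv_range(2)[OF AB(1)] by fastforce
    then have "B = D" using AB(2) field_le_epsilon[of B D] by fastforce
    then show "\<exists>A. optimal_range_interval F A D" using AB(1) by blast
  }
  {
    assume "0 \<le> \<Delta>0 \<and> \<Delta>0 \<le> \<Delta>1"
    then have above: "\<exists>f\<in>F. deriv_range f \<subseteq> {D - \<epsilon><..}" if "\<epsilon> > 0" for \<epsilon>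
      using ex_deriv_range_above[OF defs _ _ that] by (auto simp: F)
    then show "\<forall>\<epsilon>>0. \<exists>f\<in>F. deriv_range f \<subseteq> {D - \<epsilon><..}" by blast
    obtain f\<^sub>0 where "f\<^sub>0 \<in> F" using above[of 1] by auto
    then obtain A B where AB: "optimal_range_interval F A B" "A \<le> D"
      using ex_optimal_range_interval_moment_class[OF defs] unfolding F by metis
    have "D \<le> A + \<epsilon>" if "\<epsilon> > 0" for \<epsilon>
      using above[OF that] optimal_range_interval_endpoints_in_deriv_range(1)[OF AB(1)] by fastforce
    then have "A = D" using AB(2) field_le_epsilon[of D A] by fastforce
    then show "\<exists>B. optimal_range_interval F D B" using AB(1) by blast
  }
  {
    assume 0: "\<Delta>0 = 0 \<and> \<Delta>1 = 0"
    then obtain f where f: "f \<in> F" "deriv_range f = {D}"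
      using ex_deriv_range_singleton[OF defs] by (auto simp: F)
    \<comment> \<open>The left side exceeds \<open>D\<close> by \<open>20 * \<Delta>1\<close>, which
      is \<open>0\<close> here.\<close>
    have D': "20 * (4 * \<alpha> 3 - 3 * \<alpha> 2) = D"
      using 0 unfolding defs by (simp add: algebra_simps)
    show "optimal_range_interval F (20 * (4 * \<alpha> 3 - 3 * \<alpha> 2)) (20 * (4 * \<alpha> 3 - 3 * \<alpha> 2))"
      unfolding D' optimal_range_interval_def common_range_interval_def
      using f mean by auto
    have "L \<le> 0" if L: "admissible_length F L" for L
    proof -
      obtain x y where "y - x = L" "{x..y} \<subseteq> {D}"
        using L f by (metis admissible_length_def)
      \<comment> \<open>For \<open>y < x\<close> the interval is empty, but then
        \<open>L = y - x\<close> is negative and the bound holds anyway.\<close>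
      then have "x = D \<and> y = D" if "x \<le> y"
        using that by (simp add: subset_singleton_iff flip: atLeastAtMost_singleton)
      then show ?thesis using \<open>y - x = L\<close> by linarith
    qed
    moreover have "admissible_length F 0"
      unfolding admissible_length_def
    proof (intro conjI ballI)
      fix g assume "g \<in> F"
      then show "\<exists>a b. b - a = 0 \<and> {a..b} \<subseteq> deriv_range g"
        using mean by (intro exI[of _ D]) auto
    qed simp
    ultimately show "optimal_length F 0"
      by (simp add: optimal_length_def)
  }
qed

end
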